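(* Let $n,k\ge 1$ be integers, let $\mathcal{H}=\bigoplus_{i=1}^n\mathcal{H}_i\cong\mathbb{C}^{nk}$ with $\mathcal{H}_i\cong\mathbb{C}^k$, and let $I,E,B,D$ be the linear maps on $\mathcal{B}(\mathcal{H})$ defined in the context. Let $a,b,c,d\in\mathbb{R}$ and $\Phi=\Phi(a,b,c,d)=aI+bE+cB+dD$. Then $\Phi$ is completely positive if and only if $$nka+kb+\frac{c+d}{nk}\ge 0,\qquad kb+\frac{c+d}{nk}\ge 0,\qquad c+d\ge 0,\qquad d\ge 0.$$
   Context: For $i=1,\dots,n$, $\mathcal{H}_i\cong\mathbb{C}^k$ has orthonormal basis $\{e_{i,j}: j=1,\dots,k\}$, and $I_{\mathcal{H}_i}\in\mathcal{B}(\mathcal{H})$ denotes the orthogonal projection of $\mathcal{H}=\bigoplus_{i=1}^n\mathcal{H}_i$ onto $\mathcal{H}_i$. Define linear maps on $\mathcal{B}(\mathcal{H})$ by: - $I(X)=X$ (identity map); - $E(X)=\sum_{i=1}^n I_{\mathcal{H}_i}XI_{\mathcal{H}_i}$ (conditional expectation onto block-diagonal matrices); - $B(X)=\frac1n\sum_{i=1}^n \mathrm{Tr}_{\mathcal{H}_i}(X)\,I_{\mathcal{H}_i}$, where $\mathrm{Tr}_{\mathcal{H}_i}(X)=\frac1k\sum_{j=1}^k\langle e_{i,j},Xe_{i,j}\rangle$; - $D(X)=\mathrm{Tr}(X)\,I_{\mathcal{H}}$, where $\mathrm{Tr}(X)=\frac1{nk}\sum_{i=1}^n\sum_{j=1}^k\langle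 e_{i,j},Xe_{i,j}\rangle$ is the normalised trace.
   Formalization: The second and fourth inequalities are required only when n ≥ 2 and the third only when k ≥ 2; as printed the equivalence fails for n = 1 (E = I, B = D, so Φ(1,-1,0,0) = 0) and for k = 1 (nB = E, so Φ(0,1,-n,0) = 0). *)

theory Defs
  imports "HOL-Analysis.Analysis"
begin

text \<open>
  The Hilbert space \<open>H = (\<Oplus>i. H\<^sub>i)\<close>, with \<open>n = CARD('n)\<close> summands of
  dimension \<open>k = CARD('k)\<close>, is the space of complex vectors indexed by pairs
  \<open>(i, j)\<close>; operators on \<open>H\<close> are matrices indexed by such pairs.
\<close>

type_synonym ('n, 'k) hilb = "complex ^ ('n \<times> 'k)"
type_synonym ('n, 'k) bh = "complex ^ ('n \<times> 'k) ^ ('n \<times> 'k)"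

text \<open>The inner product is conjugate-linear in its first argument.\<close>

definition cinner :: "complex ^ 'p \<Rightarrow> complex ^ 'p \<Rightarrow> complex" where
  "cinner v w = (\<Sum>p\<in>UNIV. cnj (v $ p) * w $ p)"

definition cscale :: "complex \<Rightarrow> complex ^ 'p ^ 'p \<Rightarrow> complex ^ 'p ^ 'p" where
  "cscale z X = (\<chi> p q. z * X $ p $ q)"

text \<open>
  The family \<open>X r s\<close> with \<open>r, s < m\<close> is read as an \<open>m \<times> m\<close> matrix of operators,
  acting on the \<open>m\<close>-fold direct sum of the underlying space; only indices below
  \<open>m\<close> matter.
\<close>

definition block_positive :: "nat \<Rightarrow> (nat \<Rightarrow> nat \<Rightarrow> complex ^ 'p ^ 'p) \<Rightarrow> bool" where
  "block_positive m X \<longleftrightarrow>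
     (\<forall>v :: nat \<Rightarrow> complex ^ 'p.
        (\<Sum>r<m. \<Sum>s<m. cinner (v r) (X r s *v v s)) \<in> \<real>\<^sub>\<ge>\<^sub>0)"

text \<open>
  Complete positivity of a linear map: every amplification, acting entrywise on
  matrices of operators, preserves positivity. Linearity is not built into the
  predicate; for the maps considered here it is proved below.
\<close>

definition completely_positive :: "(complex ^ 'p ^ 'p \<Rightarrow> complex ^ 'p ^ 'p) \<Rightarrow> bool" where
  "completely_positive F \<longleftrightarrow>
     (\<forall>m X. block_positive m X \<longrightarrow> block_positive m (\<lambda>r s. F (X r s)))"

definition basis_vec :: "'n \<Rightarrow> 'k \<Rightarrow> ('n::finite, 'k::finite) hilb" where
  "basis_vec i j = axis (i, j) 1"

definition proj_H :: "'n \<Rightarrow> ('n::finite, 'k::finite) bh" where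
  "proj_H i = (\<chi> p q. if p = q \<and> fst p = i then 1 else 0)"

lemma proj_H_mult_vec:
  fixes v :: "('n::finite, 'k::finite) hilb"
  shows "proj_H i *v v = (\<Sum>j\<in>UNIV. cinner (basis_vec i j) v *s basis_vec i j)"
proof -
  have inn: "cinner (basis_vec i j) v = v $ (i, j)" for j :: 'k
    unfolding cinner_def basis_vec_def axis_def
    by (simp add: if_distrib[of cnj] if_distrib[of "\<lambda>x. x * _"] cong: if_cong)
  have "(proj_H i *v v) $ p = (\<Sum>j\<in>UNIV. cinner (basis_vec i j) v *s basis_vec i j) $ p" for p
  proof (cases p)
    case (Pair i' j')
    have l: "(proj_H i *v v) $ p = (if i' = i then v $ p else 0)"
      unfolding proj_H_def matrix_vector_mult_def Pair
      by (simp add: if_distrib[of "\<lambda>x. x * _"] cong: if_cong)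
    have "(\<Sum>j\<in>UNIV. cinner (basis_vec i j) v *s basis_vec i j) $ p
        = (\<Sum>j\<in>UNIV. if j = j' then (if i' = i then v $ (i, j) else 0) else 0)"
      unfolding inn sum_component by (rule sum.cong) (auto simp: basis_vec_def axis_def Pair)
    with l show ?thesis by (simp add: Pair)
  qed
  then show ?thesis by (simp add: vec_eq_iff)
qed

definition block_trace :: "'n \<Rightarrow> ('n::finite, 'k::finite) bh \<Rightarrow> complex" where
  "block_trace i X =
     1 / of_nat CARD('k) * (\<Sum>j\<in>UNIV. cinner (basis_vec i j) (X *v basis_vec i j))"

definition ntrace :: "('n::finite, 'k::finite) bh \<Rightarrow> complex" where
  "ntrace X =
     1 / of_nat (CARD('n) * CARD('k)) *
       (\<Sum>i\<in>UNIV. \<Sum>j\<in>UNIV. cinner (basis_vec i j) (X *v basis_vec i j))"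

definition map_I :: "('n::finite, 'k::finite) bh \<Rightarrow> ('n, 'k) bh" where
  "map_I X = X"

definition map_E :: "('n::finite, 'k::finite) bh \<Rightarrow> ('n, 'k) bh" where
  "map_E X = (\<Sum>i\<in>UNIV. proj_H i ** X ** proj_H i)"

definition map_B :: "('n::finite, 'k::finite) bh \<Rightarrow> ('n, 'k) bh" where
  "map_B X = cscale (1 / of_nat CARD('n)) (\<Sum>i\<in>UNIV. cscale (block_trace i X) (proj_H i))"

definition map_D :: "('n::finite, 'k::finite) bh \<Rightarrow> ('n, 'k) bh" where
  "map_D X = cscale (ntrace X) (mat 1)"

definition Phi :: "real \<Rightarrow> real \<Rightarrow> real \<Rightarrow> real \<Rightarrow> ('n::finite, 'k::finite) bh \<Rightarrow> ('n, 'k) bh" where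
  "Phi a b c d X = a *\<^sub>R map_I X + b *\<^sub>R map_E X + c *\<^sub>R map_B X + d *\<^sub>R map_D X"

lemma block_trace_add: "block_trace i (X + Y) = block_trace i X + block_trace i Y"
  by (simp add: block_trace_def cinner_def matrix_vector_mult_add_rdistrib
      sum.distrib distrib_left add_divide_distrib)

lemma ntrace_add: "ntrace (X + Y) = ntrace X + ntrace Y"
  by (simp add: ntrace_def cinner_def matrix_vector_mult_add_rdistrib
      sum.distrib distrib_left add_divide_distrib)

lemma cscale_mult_vec: "cscale z X *v v = z *s (X *v v)"
  by (simp add: vec_eq_iff cscale_def matrix_vector_mult_def sum_distrib_left mult.assoc)

lemma cinner_scale_right: "cinner v (z *s w) = z * cinner v w"
  by (simp add: cinner_def sum_distrib_left mult.left_commute)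

lemma block_trace_cscale: "block_trace i (cscale z X) = z * block_trace i X"
  by (simp add: block_trace_def cscale_mult_vec cinner_scale_right sum_distrib_left[symmetric])

lemma ntrace_cscale: "ntrace (cscale z X) = z * ntrace X"
  by (simp add: ntrace_def cscale_mult_vec cinner_scale_right sum_distrib_left[symmetric])

lemma cscale_add_left: "cscale (z + w) X = cscale z X + cscale w X"
  by (simp add: vec_eq_iff cscale_def distrib_right)

lemma cscale_add_right: "cscale z (X + Y) = cscale z X + cscale z Y"
  by (simp add: vec_eq_iff cscale_def distrib_left)

lemma cscale_cscale: "cscale z (cscale w X) = cscale (z * w) X"
  by (simp add: vec_eq_iff cscale_def mult.assoc)

lemma cscale_scaleR: "cscale z (r *\<^sub>R X) = r *\<^sub>R cscale z X"
  by (simp add: vec_eq_iff cscale_def)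

lemma cscale_sum: "cscale z (sum f A) = (\<Sum>i\<in>A. cscale z (f i))"
  by (simp add: vec_eq_iff cscale_def sum_distrib_left)

lemma matrix_mult_cscale: "A ** cscale z X ** B = cscale z (A ** X ** B)"
  by (simp add: vec_eq_iff cscale_def matrix_matrix_mult_def sum_distrib_left
      sum_distrib_right mult.assoc mult.left_commute)

lemma matrix_mult_add_left: "(A + B) ** C = A ** C + B ** (C :: complex ^ 'p ^ 'p)"
  by (simp add: vec_eq_iff matrix_matrix_mult_def distrib_right sum.distrib)

lemma Phi_add: "Phi a b c d (X + Y) = Phi a b c d X + Phi a b c d Y"
  by (simp add: Phi_def map_I_def map_E_def map_B_def map_D_def block_trace_add ntrace_add
      cscale_add_left cscale_add_right matrix_add_ldistrib matrix_mult_add_left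
      sum.distrib scaleR_add_right algebra_simps)

lemma Phi_cscale: "Phi a b c d (cscale z X) = cscale z (Phi a b c d X)"
  by (simp add: Phi_def map_I_def map_E_def map_B_def map_D_def block_trace_cscale ntrace_cscale
      cscale_add_right cscale_scaleR cscale_sum cscale_cscale matrix_mult_cscale mult.left_commute)

text \<open>
  If \<open>n = 1\<close> then \<open>E = I\<close> and \<open>B = D\<close>, and if \<open>k = 1\<close> then \<open>n B = E\<close>. So \<open>\<Phi>(1,-1,0,0)\<close>
  and \<open>\<Phi>(0,0,1,-1)\<close> vanish for \<open>n = 1\<close>, and \<open>\<Phi>(0,1,-n,0)\<close> vanishes for \<open>k = 1\<close>. The
  zero map is completely positive, hence the inequalities \<open>k b + (c + d)/(n k) \<ge> 0\<close> and
  \<open>d \<ge> 0\<close> are not necessary when \<open>n = 1\<close>, nor is \<open>c + d \<ge> 0\<close> when \<open>k = 1\<close>.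
\<close>

lemma completely_positive_zero: "completely_positive (\<lambda>_. 0)"
  by (simp add: completely_positive_def block_positive_def cinner_def)

lemma proj_H_unique_index:
  assumes "CARD('n::finite) = 1"
  shows "(proj_H i :: ('n, 'k::finite) bh) = mat 1"
proof -
  have "x = y" for x y :: 'n
    using assms by (metis UNIV_I card_1_singletonE singletonD)
  then show ?thesis by (auto simp: vec_eq_iff proj_H_def mat_def)
qed

lemma degenerate_n_E:
  assumes "CARD('n::finite) = 1"
  shows "Phi 1 (-1) 0 0 = (\<lambda>X :: ('n, 'k::finite) bh. 0)"
  using assms by (simp add: fun_eq_iff Phi_def map_I_def map_E_def proj_H_unique_index)

lemma degenerate_n_B:
  assumes "CARD('n::finite) = 1"
  shows "Phi 0 0 1 (-1) = (\<lambda>X :: ('n, 'k::finite) bh. 0)"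
proof -
  obtain i0 :: 'n where U: "(UNIV :: 'n set) = {i0}"
    using assms by (metis card_1_singletonE)
  show ?thesis
    using assms
    by (simp add: fun_eq_iff Phi_def map_B_def map_D_def proj_H_unique_index
        block_trace_def ntrace_def U cscale_cscale)
qed

lemma degenerate_k:
  assumes "CARD('k::finite) = 1"
  shows "Phi 0 1 (- real CARD('n)) 0 = (\<lambda>X :: ('n::finite, 'k) bh. 0)"
proof -
  obtain j0 :: 'k where U: "(UNIV :: 'k set) = {j0}"
    using assms by (metis card_1_singletonE)
  have j: "j = j0" for j :: 'k
    using U by blast
  have "cscale (block_trace i X) (proj_H i) = proj_H i ** X ** proj_H i"
    for X :: "('n, 'k) bh" and i
  proof -
    have "block_trace i X = X $ (i, j0) $ (i, j0)"
      using assms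
      by (simp add: block_trace_def U cinner_def basis_vec_def axis_def matrix_vector_mult_def
          if_distrib[of cnj] if_distrib[of "\<lambda>x. x * _"] if_distrib[of "\<lambda>x. _ * x"] cong: if_cong)
    moreover have "(proj_H i ** X ** proj_H i) $ p $ q
        = (if fst p = i \<and> fst q = i then X $ p $ q else 0)" for p q
    proof -
      have 1: "(proj_H i ** X) $ p $ q = (if fst p = i then X $ p $ q else 0)" for p q
        unfolding proj_H_def matrix_matrix_mult_def
        by (cases "fst p = i") (simp_all add: if_distrib[of "\<lambda>x. x * _"] cong: if_cong)
      have 2: "(Y ** proj_H i) $ p $ q = (if fst q = i then Y $ p $ q else 0)"
        for p q and Y :: "('n, 'k) bh"
      proof -
        have "(Y ** proj_H i) $ p $ q = (\<Sum>r\<in>UNIV. if r = q then (if fst q = i then Y $ p $ q else 0) else 0)"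
          unfolding proj_H_def matrix_matrix_mult_def vec_lambda_beta by (rule sum.cong) auto
        then show ?thesis by simp
      qed
      show ?thesis by (simp add: 1 2)
    qed
    ultimately show ?thesis
      by (auto simp: vec_eq_iff cscale_def proj_H_def) (metis j)+
  qed
  then have "map_B X = cscale (1 / of_nat CARD('n)) (map_E X)" for X :: "('n, 'k) bh"
    by (simp add: map_B_def map_E_def)
  moreover have "real CARD('n) *\<^sub>R cscale (1 / of_nat CARD('n)) Y = Y" for Y :: "('n, 'k) bh"
    by (simp add: vec_eq_iff cscale_def) (simp add: scaleR_conv_of_real)
  ultimately show ?thesis
    by (simp add: fun_eq_iff Phi_def)
qed

end

theory Submission
  imports Defs
begin

text \<open>
  All four maps \<open>I, E, B, D\<close> have simultaneously diagonalisable Choi matrices on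
  \<open>H \<otimes> H\<close>. Put \<open>\<Omega>\<^sub>i = (\<Sum>j. e\<^sub>i\<^sub>j \<otimes> e\<^sub>i\<^sub>j)\<close> and \<open>\<Omega> = (\<Sum>i. \<Omega>\<^sub>i)\<close>. The Choi matrix of \<open>I\<close> is
  the rank-one operator of \<open>\<Omega>\<close>, that of \<open>E\<close> is the sum of the rank-one operators of the
  \<open>\<Omega>\<^sub>i\<close>, that of \<open>n k B\<close> is the projection onto \<open>Q\<close>, the span of all
  \<open>e\<^sub>i\<^sub>j \<otimes> e\<^sub>i\<^sub>l\<close>, and that of \<open>n k D\<close> is the identity. Hence the Choi matrix of \<open>\<Phi>\<close>
  has four eigenspaces:

  \<^item> the line of \<open>\<Omega>\<close>, eigenvalue \<open>l\<^sub>1 = n k a + k b + (c + d)/(n k)\<close>;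
  \<^item> the span of the \<open>\<Omega>\<^sub>i\<close> orthogonal to \<open>\<Omega>\<close>, eigenvalue \<open>l\<^sub>2 = k b + (c + d)/(n k)\<close>,
    nonzero iff \<open>n \<ge> 2\<close>;
  \<^item> the part of \<open>Q\<close> orthogonal to all \<open>\<Omega>\<^sub>i\<close>, eigenvalue \<open>(c + d)/(n k)\<close>, nonzero iff
    \<open>k \<ge> 2\<close>;
  \<^item> the orthogonal complement of \<open>Q\<close>, eigenvalue \<open>d/(n k)\<close>, nonzero iff \<open>n \<ge> 2\<close>.

  The projections onto these spaces are, up to positive factors, the Choi matrices of
  \<open>I\<close>, \<open>n E - I\<close>, \<open>n k\<^sup>2 B - E\<close> and \<open>D - B\<close>, and
  \<open>\<Phi> = l\<^sub>1/(n k) I + l\<^sub>2/(n k) (n E - I) + (c + d)/(n k\<^sup>2) (n k\<^sup>2 B - E) + d (D - B)\<close>.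

  For sufficiency it is therefore enough that these four maps are completely positive. The
  second and third come from the pinching inequality
  \<open>(\<Sum>t. P\<^sub>t)\<^sup>* X (\<Sum>t. P\<^sub>t) \<le> N (\<Sum>t. P\<^sub>t\<^sup>* X P\<^sub>t)\<close> for \<open>N\<close> operators
  (\<open>completely_positive_pinching\<close>); the fourth only copies diagonal entries of \<open>X\<close> to
  other places of the diagonal and adds them up. A negative coefficient can occur only in front
  of a map that vanishes because its eigenspace is zero.

  For necessity, the Choi matrix of a completely positive map is positive
  (\<open>choi_form_nonneg\<close>), and evaluating its form at one vector of each nonzero eigenspace gives
  the four inequalities.
\<close>

section \<open>The cone of completely positive maps\<close>

definition adjoint_mat :: "complex ^ 'p ^ 'p \<Rightarrow> complex ^ 'p ^ 'p" where
  "adjoint_mat K = (\<chi> p q. cnj (K $ q $ p))"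

definition matrix_unit :: "'p \<Rightarrow> 'p \<Rightarrow> complex ^ 'p ^ 'p" where
  "matrix_unit p q = (\<chi> r s. if r = p \<and> s = q then 1 else 0)"

lemma cinner_add_right: "cinner v (w + u) = cinner v w + cinner v u"
  by (simp add: cinner_def sum.distrib distrib_left)

lemma cinner_adjoint_mat: "cinner v (adjoint_mat K *v w) = cinner (K *v v) w"
proof -
  have "cinner v (adjoint_mat K *v w) = (\<Sum>p\<in>UNIV. \<Sum>q\<in>UNIV. cnj (K $ q $ p * v $ p) * w $ q)"
    by (simp add: cinner_def adjoint_mat_def matrix_vector_mult_def sum_distrib_left mult_ac)
  also have "\<dots> = (\<Sum>q\<in>UNIV. \<Sum>p\<in>UNIV. cnj (K $ q $ p * v $ p) * w $ q)"
    by (rule sum.swap)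
  finally show ?thesis
    by (simp add: cinner_def matrix_vector_mult_def sum_distrib_right)
qed

text \<open>
  The form of \<open>K\<^sup>* X K\<close> at \<open>(v\<^sub>r)\<close> is the form of \<open>X\<close> at \<open>(K v\<^sub>r)\<close>. Positive
  combinations of such maps are the source of complete positivity below.
\<close>

lemma completely_positive_conj:
  "completely_positive (\<lambda>X. adjoint_mat K ** X ** K)"
  unfolding completely_positive_def block_positive_def
proof (intro allI impI)
  fix m and X :: "nat \<Rightarrow> nat \<Rightarrow> complex ^ 'a ^ 'a" and v :: "nat \<Rightarrow> complex ^ 'a"
  assume "\<forall>v. (\<Sum>r<m. \<Sum>s<m. cinner (v r) (X r s *v v s)) \<in> \<real>\<^sub>\<ge>\<^sub>0"
  from spec[OF this, of "\<lambda>r. K *v v r"]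
  show "(\<Sum>r<m. \<Sum>s<m. cinner (v r) ((adjoint_mat K ** X r s ** K) *v v s)) \<in> \<real>\<^sub>\<ge>\<^sub>0"
    by (simp add: cinner_adjoint_mat flip: matrix_vector_mul_assoc)
qed

lemma completely_positive_add:
  assumes "completely_positive F" "completely_positive G"
  shows "completely_positive (\<lambda>X. F X + G X)"
  using assms
  by (auto simp: completely_positive_def block_positive_def matrix_vector_mult_add_rdistrib
      cinner_add_right sum.distrib intro!: nonneg_Reals_add_I)

lemma completely_positive_sum:
  assumes "\<And>t. t \<in> A \<Longrightarrow> completely_positive (F t)"
  shows "completely_positive (\<lambda>X. \<Sum>t\<in>A. F t X)"
  using assms
  by (induction A rule: infinite_finite_induct)
    (simp_all add: completely_positive_zero completely_positive_add)

lemma completely_positive_scaleR: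
  assumes "0 \<le> t" "completely_positive F"
  shows "completely_positive (\<lambda>X. t *\<^sub>R F X)"
proof -
  have "cinner v ((t *\<^sub>R Y) *v w) = of_real t * cinner v (Y *v w)" for v w and Y :: "complex^'a^'a"
  proof -
    have "t *\<^sub>R Y = cscale (of_real t) Y"
      by (simp add: vec_eq_iff cscale_def) (simp add: scaleR_conv_of_real)
    then show ?thesis by (simp add: cscale_mult_vec cinner_scale_right)
  qed
  with assms show ?thesis
    by (auto simp: completely_positive_def block_positive_def simp flip: sum_distrib_left
        intro!: nonneg_Reals_mult_I)
qed

section \<open>The pinching inequality\<close>

lemma matrix_mult_sum_left: "(\<Sum>t\<in>A. f t) ** (Y :: complex ^ 'p ^ 'p) = (\<Sum>t\<in>A. f t ** Y)"
  by (induction A rule: infinite_finite_induct) (simp_all add: matrix_mult_add_left)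

lemma matrix_mult_sum_right: "(Y :: complex ^ 'p ^ 'p) ** (\<Sum>t\<in>A. f t) = (\<Sum>t\<in>A. Y ** f t)"
  by (induction A rule: infinite_finite_induct) (simp_all add: matrix_add_ldistrib)

lemma adjoint_mat_diff: "adjoint_mat (K - L) = adjoint_mat K - adjoint_mat L"
  by (simp add: adjoint_mat_def vec_eq_iff)

lemma adjoint_mat_one: "adjoint_mat (mat 1) = mat 1"
  by (auto simp: adjoint_mat_def mat_def vec_eq_iff)

lemma adjoint_mat_sum: "adjoint_mat (\<Sum>t\<in>A. P t) = (\<Sum>t\<in>A. adjoint_mat (P t))"
  by (simp add: adjoint_mat_def vec_eq_iff)

text \<open>
  Expanding the squares shows that the map is half the sum over all pairs \<open>(s, t)\<close> of
  \<open>X \<mapsto> (P\<^sub>s - P\<^sub>t)\<^sup>* X (P\<^sub>s - P\<^sub>t)\<close>. This is the operator form of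
  \<open>N (\<Sum>t. \<bar>x\<^sub>t\<bar>\<^sup>2) - \<bar>\<Sum>t. x\<^sub>t\<bar>\<^sup>2 = (\<Sum>s t. \<bar>x\<^sub>s - x\<^sub>t\<bar>\<^sup>2) / 2\<close>, the identity behind the Cauchy-Schwarz
  inequality.
\<close>

lemma completely_positive_pinching:
  fixes P :: "'t \<Rightarrow> complex ^ 'p ^ 'p"
  shows "completely_positive (\<lambda>X. real (card A) *\<^sub>R (\<Sum>t\<in>A. adjoint_mat (P t) ** X ** P t)
           - adjoint_mat (\<Sum>t\<in>A. P t) ** X ** (\<Sum>t\<in>A. P t))"
proof -
  have "(1/2) *\<^sub>R (\<Sum>s\<in>A. \<Sum>t\<in>A. adjoint_mat (P s - P t) ** X ** (P s - P t))
      = real (card A) *\<^sub>R (\<Sum>t\<in>A. adjoint_mat (P t) ** X ** P t)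
           - adjoint_mat (\<Sum>t\<in>A. P t) ** X ** (\<Sum>t\<in>A. P t)" for X
  proof -
    let ?Q = "\<lambda>s t. adjoint_mat (P s) ** X ** P t"
    have 1: "adjoint_mat (P s - P t) ** X ** (P s - P t) = ?Q s s - ?Q s t - ?Q t s + ?Q t t" for s t
      unfolding adjoint_mat_diff
      by (simp add: vec_eq_iff matrix_matrix_mult_def algebra_simps sum.distrib sum_subtractf
          sum_distrib_left sum_distrib_right)
    have 2: "adjoint_mat (\<Sum>t\<in>A. P t) ** X ** (\<Sum>t\<in>A. P t) = (\<Sum>s\<in>A. \<Sum>t\<in>A. ?Q s t)"
      by (simp add: adjoint_mat_sum matrix_mult_sum_left matrix_mult_sum_right)
         (rule sum.swap)
    have 3: "(\<Sum>s\<in>A. \<Sum>t\<in>A. ?Q t s) = (\<Sum>s\<in>A. \<Sum>t\<in>A. ?Q s t)"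
      by (rule sum.swap)
    have 4: "(\<Sum>t\<in>A. c) = real (card A) *\<^sub>R c" for c :: "complex ^ 'p ^ 'p"
      by (simp add: sum_constant_scaleR del: sum_constant)
    have 5: "Y - Z - Z + Y = (Y - Z) + (Y - Z)" for Y Z :: "complex ^ 'p ^ 'p"
      by simp
    show ?thesis
      unfolding 1 2 sum.distrib sum_subtractf 3 4 scaleR_right.sum[symmetric]
      by (simp only: 5 scaleR_half_double)
  qed
  moreover have "completely_positive
      (\<lambda>X. (1/2) *\<^sub>R (\<Sum>s\<in>A. \<Sum>t\<in>A. adjoint_mat (P s - P t) ** X ** (P s - P t)))"
    by (intro completely_positive_scaleR completely_positive_sum completely_positive_conj) simp
  ultimately show ?thesis by simp
qed

section \<open>Matrix entries of the maps\<close>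

lemma matrix_vector_mult_axis_nth: "(X *v axis q 1) $ p = (X :: complex ^ 'p ^ 'p) $ p $ q"
  by (simp add: matrix_vector_mult_def axis_def if_distrib[of "\<lambda>x. _ * x"] cong: if_cong)

lemma cinner_axis: "cinner (axis p 1) v = v $ p"
  by (simp add: cinner_def axis_def if_distrib[of cnj] if_distrib[of "\<lambda>x. x * _"] cong: if_cong)

lemma block_trace_entries:
  fixes X :: "('n::finite, 'k::finite) bh"
  shows "block_trace i X = (\<Sum>j\<in>UNIV. X $ (i, j) $ (i, j)) / of_nat CARD('k)"
  by (simp add: block_trace_def basis_vec_def cinner_axis matrix_vector_mult_axis_nth)

lemma sum_pairs:
  fixes f :: "'n::finite \<times> 'k::finite \<Rightarrow> 'a::comm_monoid_add"
  shows "(\<Sum>p\<in>UNIV. f p) = (\<Sum>i\<in>UNIV. \<Sum>j\<in>UNIV. f (i, j))"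
  by (simp add: sum.cartesian_product)

lemma ntrace_entries:
  fixes X :: "('n::finite, 'k::finite) bh"
  shows "ntrace X = (\<Sum>p\<in>UNIV. X $ p $ p) / of_nat (CARD('n) * CARD('k))"
  by (simp add: ntrace_def basis_vec_def cinner_axis matrix_vector_mult_axis_nth
      sum_pairs)

lemma sum_block:
  fixes f :: "'n::finite \<times> 'k::finite \<Rightarrow> 'a::comm_monoid_add"
  shows "(\<Sum>p\<in>UNIV. if fst p = i then f p else 0) = (\<Sum>j\<in>UNIV. f (i, j))"
proof -
  have "(\<Sum>p\<in>UNIV. if fst p = i then f p else 0) = (\<Sum>i'\<in>UNIV. \<Sum>j\<in>UNIV. if i' = i then f (i', j) else 0)"
    by (simp add: sum_pairs)
  also have "\<dots> = (\<Sum>i'\<in>UNIV. if i' = i then (\<Sum>j\<in>UNIV. f (i', j)) else 0)"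
    by (rule sum.cong) auto
  finally show ?thesis by simp
qed

lemma mult_proj_H_nth:
  fixes X :: "('n::finite, 'k::finite) bh"
  shows "(X ** proj_H i) $ x $ y = (if fst y = i then X $ x $ y else 0)"
proof -
  have "(X ** proj_H i) $ x $ y
      = (\<Sum>r\<in>UNIV. if r = y then (if fst y = i then X $ x $ y else 0) else 0)"
    unfolding proj_H_def matrix_matrix_mult_def vec_lambda_beta by (rule sum.cong) auto
  then show ?thesis by simp
qed

lemma proj_H_mult_nth:
  fixes X :: "('n::finite, 'k::finite) bh"
  shows "(proj_H i ** X) $ x $ y = (if fst x = i then X $ x $ y else 0)"
  unfolding proj_H_def matrix_matrix_mult_def
  by (cases "fst x = i") (simp_all add: if_distrib[of "\<lambda>x. x * _"] cong: if_cong)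

lemma map_E_nth:
  fixes X :: "('n::finite, 'k::finite) bh"
  shows "map_E X $ x $ y = (if fst x = fst y then X $ x $ y else 0)"
proof -
  have "map_E X $ x $ y
      = (\<Sum>i\<in>UNIV. if i = fst x then (if fst x = fst y then X $ x $ y else 0) else 0)"
    unfolding map_E_def sum_component by (rule sum.cong) (auto simp: mult_proj_H_nth proj_H_mult_nth)
  then show ?thesis by simp
qed

lemma map_B_nth:
  fixes X :: "('n::finite, 'k::finite) bh"
  shows "map_B X $ x $ y
    = (if x = y then \<Sum>p\<in>UNIV. if fst p = fst x then X $ p $ p else 0 else 0)
        / of_nat (CARD('n) * CARD('k))"
proof -
  have "(\<Sum>i\<in>UNIV. cscale (block_trace i X) (proj_H i)) $ x $ y
      = (\<Sum>i\<in>UNIV. if i = fst x then (if x = y then block_trace i X else 0) else 0)"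
    unfolding sum_component by (rule sum.cong) (auto simp: cscale_def proj_H_def)
  then show ?thesis
    by (simp add: map_B_def cscale_def[of "1 / _"] sum_block block_trace_entries)
qed

lemma map_D_nth:
  fixes X :: "('n::finite, 'k::finite) bh"
  shows "map_D X $ x $ y
    = (if x = y then \<Sum>p\<in>UNIV. X $ p $ p else 0) / of_nat (CARD('n) * CARD('k))"
  by (simp add: map_D_def cscale_def mat_def ntrace_entries)

section \<open>The eigenprojections as completely positive maps\<close>

lemma mult_matrix_unit_nth:
  "((X :: complex ^ 'p ^ 'p) ** matrix_unit p q) $ x $ y = (if y = q then X $ x $ p else 0)"
  by (simp add: matrix_matrix_mult_def matrix_unit_def if_distrib[of "\<lambda>x. _ * x"] cong: if_cong)

lemma adjoint_matrix_unit: "adjoint_mat (matrix_unit p q) = matrix_unit q p"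
  by (auto simp: adjoint_mat_def matrix_unit_def vec_eq_iff)

lemma matrix_unit_mult_nth:
  "(matrix_unit p q ** (X :: complex ^ 'p ^ 'p)) $ x $ y = (if x = p then X $ q $ y else 0)"
  by (simp add: matrix_matrix_mult_def matrix_unit_def if_distrib[of "\<lambda>x. x * _"] cong: if_cong)

text \<open>
  The single Kraus operator is the matrix unit at \<open>(p, x)\<close>; the Choi matrix of this map is the
  projection onto \<open>e\<^sub>p \<otimes> e\<^sub>x\<close>.
\<close>

lemma completely_positive_entry:
  "completely_positive (\<lambda>X. cscale (X $ p $ p) (matrix_unit x x))"
proof -
  have "adjoint_mat (matrix_unit p x) ** X ** matrix_unit p x = cscale (X $ p $ p) (matrix_unit x x)"
    for X :: "complex ^ 'a ^ 'a"
    by (simp add: vec_eq_iff adjoint_matrix_unit mult_matrix_unit_nth matrix_unit_mult_nth cscale_def)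
       (simp add: matrix_unit_def)
  with completely_positive_conj[of "matrix_unit p x"] show ?thesis by simp
qed

lemma adjoint_proj_H: "adjoint_mat (proj_H i) = proj_H i"
  by (auto simp: adjoint_mat_def proj_H_def vec_eq_iff)

lemma sum_proj_H: "(\<Sum>i\<in>UNIV. proj_H i) = (mat 1 :: ('n::finite, 'k::finite) bh)"
proof -
  have "(\<Sum>i\<in>UNIV. proj_H i) $ x $ y = (\<Sum>i\<in>UNIV. if i = fst x then (if x = y then 1 else 0 :: complex) else 0)"
    for x y :: "'n \<times> 'k"
    unfolding sum_component by (rule sum.cong) (auto simp: proj_H_def)
  then show ?thesis by (simp add: vec_eq_iff mat_def)
qed

lemma sum_matrix_unit_block:
  "(\<Sum>j\<in>UNIV. matrix_unit (i, j) (i, j)) = (proj_H i :: ('n::finite, 'k::finite) bh)"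
proof -
  have "(\<Sum>j\<in>UNIV. matrix_unit (i, j) (i, j)) $ x $ y
      = (\<Sum>j\<in>UNIV. if j = snd x then (if x = y \<and> fst x = i then 1 else 0 :: complex) else 0)"
    for x y :: "'n \<times> 'k"
    unfolding sum_component by (rule sum.cong) (auto simp: matrix_unit_def prod_eq_iff)
  then show ?thesis by (simp add: vec_eq_iff proj_H_def)
qed

lemma completely_positive_I:
  "completely_positive (map_I :: ('n::finite, 'k::finite) bh \<Rightarrow> _)"
  by (simp add: completely_positive_def map_I_def)

text \<open>Pinching by the \<open>n\<close> block projections, which add up to the identity.\<close>

lemma completely_positive_nE_minus_I:
  "completely_positive (\<lambda>X :: ('n::finite, 'k::finite) bh. real CARD('n) *\<^sub>R map_E X - map_I X)"
  using completely_positive_pinching[of UNIV "proj_H :: 'n \<Rightarrow> ('n, 'k) bh"]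
  by (simp add: adjoint_proj_H sum_proj_H adjoint_mat_one map_E_def map_I_def)

text \<open>
  Inside each block, pinching by the \<open>k\<close> rank-one diagonal projections gives
  \<open>k diag(X) - E(X)\<close>, where \<open>diag\<close> keeps the diagonal of \<open>X\<close> only. What is missing from
  \<open>n k\<^sup>2 B(X)\<close>, whose diagonal entries are \<open>k\<close> times the unnormalised block traces, is
  \<open>k\<close> times the diagonal entries transported to other positions of the same block.
\<close>

lemma completely_positive_nkkB_minus_E:
  "completely_positive (\<lambda>X :: ('n::finite, 'k::finite) bh.
     (real CARD('n) * (real CARD('k))\<^sup>2) *\<^sub>R map_B X - map_E X)"
proof -
  \<comment> \<open>\<open>?F\<close> transports diagonal entries within a block, \<open>?G\<close> is the pinching difference.\<close>
  let ?F = "\<lambda>X :: ('n, 'k) bh. real CARD('k) *\<^sub>R (\<Sum>x\<in>UNIV. \<Sum>p\<in>{p. fst p = fst x \<and> p \<noteq> x}.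
      cscale (X $ p $ p) (matrix_unit x x))"
  let ?G = "\<lambda>X :: ('n, 'k) bh. \<Sum>i\<in>UNIV. real CARD('k) *\<^sub>R
      (\<Sum>j\<in>UNIV. adjoint_mat (matrix_unit (i, j) (i, j)) ** X ** matrix_unit (i, j) (i, j))
      - adjoint_mat (\<Sum>j\<in>UNIV. matrix_unit (i, j) (i, j)) ** X ** (\<Sum>j\<in>UNIV. matrix_unit (i, j) (i, j))"
  have "completely_positive (\<lambda>X. ?F X + ?G X)"
    by (intro completely_positive_add completely_positive_scaleR completely_positive_sum
        completely_positive_entry completely_positive_pinching) simp
  moreover have "?F X + ?G X = (real CARD('n) * (real CARD('k))\<^sup>2) *\<^sub>R map_B X - map_E X" for X
  proof -
    have F: "(\<Sum>x\<in>UNIV. \<Sum>p\<in>{p. fst p = fst x \<and> p \<noteq> x}. cscale (X $ p $ p) (matrix_unit x x)) $ z $ y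
        = (if z = y then (\<Sum>p\<in>UNIV. if fst p = fst z then X $ p $ p else 0) - X $ z $ z else 0)"
      for z y
    proof -
      have "(\<Sum>x\<in>UNIV. \<Sum>p\<in>{p. fst p = fst x \<and> p \<noteq> x}. cscale (X $ p $ p) (matrix_unit x x)) $ z $ y
        = (\<Sum>x\<in>UNIV. if x = z then (if z = y then
             \<Sum>p\<in>{p. fst p = fst x \<and> p \<noteq> x}. X $ p $ p else 0) else 0)"
        unfolding sum_component by (rule sum.cong) (auto simp: cscale_def matrix_unit_def)
      also have "\<dots> = (if z = y then \<Sum>p\<in>{p. fst p = fst z} - {z}. X $ p $ p else 0)"
        by (simp add: set_diff_eq)
      finally show ?thesis
        by (simp add: sum_diff1 sum.If_cases)
    qed
    have G1: "(\<Sum>i\<in>UNIV. \<Sum>j\<in>UNIV. matrix_unit (i, j) (i, j) ** X ** matrix_unit (i, j) (i, j)) $ z $ y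
        = (if z = y then X $ z $ z else 0)" for z y
    proof -
      have "(\<Sum>i\<in>UNIV. \<Sum>j\<in>UNIV. matrix_unit (i, j) (i, j) ** X ** matrix_unit (i, j) (i, j)) $ z $ y
        = (\<Sum>p\<in>UNIV. matrix_unit p p ** X ** matrix_unit p p) $ z $ y"
        by (simp add: sum_pairs)
      also have "\<dots> = (\<Sum>p\<in>UNIV. if p = z then (if z = y then X $ z $ z else 0) else 0)"
        unfolding sum_component
        by (rule sum.cong) (auto simp: mult_matrix_unit_nth matrix_unit_mult_nth)
      finally show ?thesis by simp
    qed
    have G: "?G X = real CARD('k) *\<^sub>R (\<Sum>i\<in>UNIV. \<Sum>j\<in>UNIV. matrix_unit (i, j) (i, j) ** X ** matrix_unit (i, j) (i, j)) - map_E X"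
      by (simp only: sum_matrix_unit_block adjoint_matrix_unit adjoint_proj_H map_E_def sum_subtractf
        scaleR_right.sum)
    have "(?F X + ?G X) $ z $ y
        = ((real CARD('n) * (real CARD('k))\<^sup>2) *\<^sub>R map_B X - map_E X) $ z $ y" for z y
      unfolding G vector_add_component vector_minus_component vector_scaleR_component F G1 map_B_nth map_E_nth
      by (cases "z = y") (simp_all add: scaleR_conv_of_real power2_eq_square right_diff_distrib)
    then show ?thesis by (simp add: vec_eq_iff)
  qed
  ultimately show ?thesis by simp
qed

text \<open>
  Up to the factor \<open>1/(n k)\<close> the difference puts at each diagonal position the sum of the
  diagonal entries of \<open>X\<close> in all the other blocks.
\<close>

lemma completely_positive_D_minus_B:
  "completely_positive (\<lambda>X :: ('n::finite, 'k::finite) bh. map_D X - map_B X)"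
proof -
  let ?F = "\<lambda>X :: ('n, 'k) bh. (1 / (real CARD('n) * real CARD('k))) *\<^sub>R
    (\<Sum>x\<in>(UNIV :: ('n \<times> 'k) set). \<Sum>p\<in>{p. fst p \<noteq> fst x}. cscale (X $ p $ p) (matrix_unit x x))"
  have "completely_positive ?F"
    by (intro completely_positive_scaleR completely_positive_sum completely_positive_entry) simp
  moreover have "?F X = map_D X - map_B X" for X
  proof -
    have F: "(\<Sum>x\<in>UNIV. \<Sum>p\<in>{p. fst p \<noteq> fst x}. cscale (X $ p $ p) (matrix_unit x x)) $ z $ y
        = (if z = y then (\<Sum>p\<in>UNIV. X $ p $ p) - (\<Sum>p\<in>UNIV. if fst p = fst z then X $ p $ p else 0) else 0)"
      for z y :: "'n \<times> 'k"
    proof -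
      have "(\<Sum>x\<in>UNIV. \<Sum>p\<in>{p. fst p \<noteq> fst x}. cscale (X $ p $ p) (matrix_unit x x)) $ z $ y
        = (\<Sum>x\<in>UNIV. if x = z then (if z = y then
             \<Sum>p\<in>{p. fst p \<noteq> fst x}. X $ p $ p else 0) else 0)"
        unfolding sum_component by (rule sum.cong) (auto simp: cscale_def matrix_unit_def)
      also have "\<dots> = (if z = y then \<Sum>p\<in>UNIV - {p. fst p = fst z}. X $ p $ p else 0)"
        by (simp add: set_diff_eq)
      finally show ?thesis
        by (simp add: sum_diff sum.If_cases)
    qed
    have "?F X $ z $ y = (map_D X - map_B X) $ z $ y" for z y
      unfolding vector_minus_component vector_scaleR_component F map_B_nth map_D_nth
      by (cases "z = y") (simp_all add: scaleR_conv_of_real diff_divide_distrib)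
    then show ?thesis by (simp add: vec_eq_iff)
  qed
  ultimately show ?thesis by simp
qed

text \<open>
  \<open>P\<close> stands for the condition (\<open>n \<ge> 2\<close> or \<open>k \<ge> 2\<close>) under which an eigenspace of the Choi matrix
  is nonzero.
\<close>

lemma completely_positive_scaleR_or_zero:
  assumes "completely_positive F" "P \<longrightarrow> 0 \<le> t" "\<not> P \<Longrightarrow> \<forall>X. F X = 0"
  shows "completely_positive (\<lambda>X. t *\<^sub>R F X)"
  using assms by (cases P) (simp_all add: completely_positive_scaleR completely_positive_zero)

text \<open>
  Used with \<open>N = n\<close>, \<open>M = n k\<^sup>2\<close> and the rescaled eigenvalues as \<open>x\<close>, \<open>y\<close>, \<open>z\<close>, \<open>d\<close>.
\<close>

lemma Phi_regroup:
  "x *\<^sub>R map_I X + y *\<^sub>R (N *\<^sub>R map_E X - map_I X) + z *\<^sub>R (M *\<^sub>R map_B X - map_E X) + d *\<^sub>R (map_D X - map_B X)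
    = Phi (x - y) (y * N - z) (z * M - d) d X"
  unfolding Phi_def by (simp add: algebra_simps)

section \<open>Positivity of the Choi matrix\<close>

lemma cinner_matrix_unit: "cinner v (matrix_unit p q *v w) = cnj (v $ p) * w $ q"
proof -
  have "(matrix_unit p q *v w) $ r = (if r = p then w $ q else 0)" for r
    by (simp add: matrix_vector_mult_def matrix_unit_def if_distrib[of "\<lambda>x. x * _"] cong: if_cong)
  then show ?thesis
    by (simp add: cinner_def if_distrib[of "\<lambda>x. _ * x"] cong: if_cong)
qed

text \<open>
  The block matrix whose \<open>(p, q)\<close> entry is the matrix unit at \<open>(p, q)\<close> is positive: its form at
  \<open>(u\<^sub>p)\<close> is the squared modulus of \<open>(\<Sum>p. u\<^sub>p(p))\<close>. Its image under the amplified \<open>F\<close> is the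
  Choi matrix of \<open>F\<close>. An enumeration \<open>e\<close> of the index type turns it into a block matrix
  indexed by natural numbers.
\<close>

lemma choi_form_nonneg:
  fixes v :: "'p::finite \<Rightarrow> complex ^ 'p"
  assumes "completely_positive F"
  shows "(\<Sum>p\<in>UNIV. \<Sum>q\<in>UNIV. cinner (v p) (F (matrix_unit p q) *v v q)) \<in> \<real>\<^sub>\<ge>\<^sub>0"
proof -
  obtain e where e: "bij_betw e {..<CARD('p)} (UNIV :: 'p set)"
    using ex_bij_betw_nat_finite[of "UNIV :: 'p set"] by (auto simp: atLeast0LessThan)
  have "block_positive CARD('p) (\<lambda>r s. matrix_unit (e r) (e s))"
    unfolding block_positive_def
  proof
    fix u :: "nat \<Rightarrow> complex ^ 'p"
    let ?z = "\<Sum>r<CARD('p). u r $ e r"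
    have "(\<Sum>r<CARD('p). \<Sum>s<CARD('p). cinner (u r) (matrix_unit (e r) (e s) *v u s)) = cnj ?z * ?z"
      by (simp add: cinner_matrix_unit sum_product)
    also have "\<dots> = of_real ((cmod ?z)\<^sup>2)"
      by (rule trans[OF mult.commute complex_norm_square[symmetric]])
    finally show "(\<Sum>r<CARD('p). \<Sum>s<CARD('p). cinner (u r) (matrix_unit (e r) (e s) *v u s)) \<in> \<real>\<^sub>\<ge>\<^sub>0"
      by (simp only: nonneg_Reals_of_real_iff zero_le_power2)
  qed
  with assms have "block_positive CARD('p) (\<lambda>r s. F (matrix_unit (e r) (e s)))"
    by (simp add: completely_positive_def)
  then have "(\<Sum>r<CARD('p). \<Sum>s<CARD('p).
      cinner (v (e r)) (F (matrix_unit (e r) (e s)) *v v (e s))) \<in> \<real>\<^sub>\<ge>\<^sub>0"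
    unfolding block_positive_def by (rule allE[of _ "\<lambda>r. v (e r)"])
  then show ?thesis
    by (simp add: sum.reindex_bij_betw[OF e, symmetric])
qed

text \<open>
  The Choi form at the vector \<open>\<Sum>p. g(p) (e\<^sub>p \<otimes> e'\<^sub>p)\<close>, where \<open>e'\<^sub>p\<close> is the basis vector at
  \<open>f p\<close>. Such vectors suffice to reach all the eigenspaces of the Choi matrix of \<open>\<Phi>\<close>.
\<close>

lemma choi_entries_nonneg:
  fixes g :: "'p::finite \<Rightarrow> real" and f :: "'p \<Rightarrow> 'p"
  assumes "completely_positive F"
  shows "(\<Sum>p\<in>UNIV. \<Sum>q\<in>UNIV. of_real (g p * g q) * F (matrix_unit p q) $ f p $ f q) \<in> \<real>\<^sub>\<ge>\<^sub>0"
proof -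
  have "cinner (of_real s *s axis x 1) (Y *v (of_real t *s axis y 1)) = of_real (s * t) * Y $ x $ y"
    for s t x y and Y :: "complex ^ 'p ^ 'p"
  proof -
    have "(Y *v (of_real t *s axis y 1)) $ r = of_real t * Y $ r $ y" for r
      by (simp add: matrix_vector_mult_def axis_def if_distrib[of "\<lambda>x. _ * x"] cong: if_cong)
    then show ?thesis
      by (simp add: cinner_def axis_def if_distrib[of "\<lambda>x. _ * x"] if_distrib[of cnj]
         if_distrib[of "\<lambda>x. x * _"] cong: if_cong)
  qed
  with choi_form_nonneg[OF assms, of "\<lambda>p. of_real (g p) *s axis (f p) 1"] show ?thesis
    by simp
qed

lemma Phi_matrix_unit_nth:
  fixes p q x y :: "'n::finite \<times> 'k::finite"
  shows "Phi a b c d (matrix_unit p q) $ x $ y = of_real (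
      (if x = p \<and> y = q then a + (if fst x = fst y then b else 0) else 0)
      + (if x = y \<and> p = q then ((if fst p = fst x then c else 0) + d) / (real CARD('n) * real CARD('k)) else 0))"
proof -
  have 1: "(\<Sum>r\<in>UNIV. matrix_unit p q $ r $ r) = (if p = q then 1 else 0 :: complex)"
  proof -
    have "(\<Sum>r\<in>UNIV. matrix_unit p q $ r $ r) = (\<Sum>r\<in>UNIV. if r = p then (if p = q then 1 else 0 :: complex) else 0)"
      by (rule sum.cong) (auto simp: matrix_unit_def)
    then show ?thesis by simp
  qed
  have 2: "(\<Sum>r\<in>UNIV. if fst r = i then matrix_unit p q $ r $ r else 0) = (if p = q \<and> fst p = i then 1 else 0 :: complex)"
    for i
  proof -
    have "(\<Sum>r\<in>UNIV. if fst r = i then matrix_unit p q $ r $ r else 0)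
       = (\<Sum>r\<in>UNIV. if r = p then (if p = q \<and> fst p = i then 1 else 0 :: complex) else 0)"
      by (rule sum.cong) (auto simp: matrix_unit_def)
    then show ?thesis by simp
  qed
  have 3: "matrix_unit p q $ x $ y = (if x = p \<and> y = q then 1 else 0 :: complex)"
    by (simp add: matrix_unit_def)
  have 4: "a *\<^sub>R (if A then 1 else 0) + b *\<^sub>R (if S then if A then 1 else 0 else 0)
      + c *\<^sub>R ((if X then if P \<and> G then 1 else 0 else 0) / of_nat (N * K))
      + d *\<^sub>R ((if X then if P then 1 else 0 else 0) / of_nat (N * K))
    = (of_real ((if A then a + (if S then b else 0) else 0)
      + (if X \<and> P then ((if G then c else 0) + d) / (real N * real K) else 0)) :: complex)"
    for A S X P G N K
    by (simp add: scaleR_conv_of_real add_divide_distrib)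
  show ?thesis
    unfolding Phi_def map_I_def vector_add_component vector_scaleR_component
      map_E_nth map_B_nth map_D_nth 1 2 3
    by (rule 4)
qed

text \<open>
  The Choi form of \<open>\<Phi>\<close> at \<open>\<Sum>i. h(i) \<Omega>\<^sub>i\<close>, divided by \<open>k\<close>. It separates the two eigenvalues on the
  span of the \<open>\<Omega>\<^sub>i\<close>: up to a positive factor, constant \<open>h\<close>
  gives \<open>l\<^sub>1\<close>, and nonzero \<open>h\<close> of sum zero gives \<open>l\<^sub>2\<close>.
\<close>

lemma choi_block_vector_nonneg:
  fixes h :: "'n::finite \<Rightarrow> real"
  assumes "completely_positive (Phi a b c d :: ('n, 'k::finite) bh \<Rightarrow> _)"
  shows "0 \<le> real CARD('k) * a * (\<Sum>i\<in>UNIV. h i)\<^sup>2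
    + (real CARD('k) * b + (c + d) / (real CARD('n) * real CARD('k))) * (\<Sum>i\<in>UNIV. (h i)\<^sup>2)"
proof -
  let ?t = "(c + d) / (real CARD('n) * real CARD('k))"
  let ?S = "\<Sum>p\<in>UNIV. \<Sum>q\<in>(UNIV :: ('n \<times> 'k) set). h (fst p) * h (fst q) *
      (a + (if fst q = fst p then b else 0) + (if q = p then ?t else 0))"
  have "of_real ?S \<in> (\<real>\<^sub>\<ge>\<^sub>0 :: complex set)"
  proof -
    have "(of_real ?S :: complex) = (\<Sum>p\<in>UNIV. \<Sum>q\<in>(UNIV :: ('n \<times> 'k) set). of_real (h (fst p) * h (fst q)) *
       Phi a b c d (matrix_unit p q) $ p $ q)"
      unfolding of_real_sum
      by (intro sum.cong refl) (auto simp: Phi_matrix_unit_nth)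
    with choi_entries_nonneg[OF assms, of "\<lambda>p. h (fst p)" "\<lambda>p. p"] show ?thesis by simp
  qed
  then have S: "0 \<le> ?S" by (simp only: nonneg_Reals_of_real_iff)
  have blk: "(\<Sum>p\<in>(UNIV :: ('n \<times> 'k) set). f (fst p)) = real CARD('k) * (\<Sum>i\<in>UNIV. f i)" for f :: "'n \<Rightarrow> real"
  proof -
    have "(\<Sum>p\<in>(UNIV :: ('n \<times> 'k) set). f (fst p)) = (\<Sum>i\<in>UNIV. \<Sum>j\<in>(UNIV :: 'k set). f i)"
      by (simp add: sum_pairs)
    then show ?thesis by (simp flip: sum_distrib_left)
  qed
  have inner: "(\<Sum>q\<in>(UNIV :: ('n \<times> 'k) set). h (fst p) * h (fst q) *
      (a + (if fst q = fst p then b else 0) + (if q = p then ?t else 0)))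
    = real CARD('k) * a * (\<Sum>i\<in>UNIV. h i) * h (fst p) + (real CARD('k) * b + ?t) * (h (fst p))\<^sup>2" for p :: "'n \<times> 'k"
  proof -
    have "(\<Sum>q\<in>(UNIV :: ('n \<times> 'k) set). h (fst p) * h (fst q) *
      (a + (if fst q = fst p then b else 0) + (if q = p then ?t else 0)))
     = (\<Sum>q\<in>(UNIV :: ('n \<times> 'k) set). a * h (fst p) * h (fst q))
      + (\<Sum>q\<in>(UNIV :: ('n \<times> 'k) set). if fst q = fst p then b * (h (fst p))\<^sup>2 else 0)
      + (\<Sum>q\<in>(UNIV :: ('n \<times> 'k) set). if q = p then ?t * (h (fst p))\<^sup>2 else 0)"
      unfolding sum.distrib[symmetric]
      by (rule sum.cong) (auto simp: algebra_simps power2_eq_square)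
    also have "(\<Sum>q\<in>(UNIV :: ('n \<times> 'k) set). a * h (fst p) * h (fst q)) = real CARD('k) * a * (\<Sum>i\<in>UNIV. h i) * h (fst p)"
      by (simp add: blk flip: sum_distrib_left)
    finally show ?thesis by (simp add: sum_block distrib_right)
  qed
  have "?S = real CARD('k) * (real CARD('k) * a * (\<Sum>i\<in>UNIV. h i)\<^sup>2 + (real CARD('k) * b + ?t) * (\<Sum>i\<in>UNIV. (h i)\<^sup>2))"
    unfolding inner sum.distrib sum_distrib_left[symmetric] blk[of h] blk[of "\<lambda>i. (h i)\<^sup>2"]
    by (simp add: power2_eq_square algebra_simps)
  with S show ?thesis by (simp add: zero_le_mult_iff)
qed

text \<open>The Choi form at the product vector \<open>e\<^sub>p \<otimes> e\<^sub>x\<close>.\<close>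

lemma choi_diagonal_nonneg:
  assumes "completely_positive F"
  shows "F (matrix_unit p p) $ x $ x \<in> \<real>\<^sub>\<ge>\<^sub>0"
proof -
  have inner: "(\<Sum>s\<in>UNIV. of_real (of_bool (r = p) * of_bool (s = p)) * F (matrix_unit r s) $ x $ x)
      = (if r = p then F (matrix_unit p p) $ x $ x else 0)" for r
  proof -
    have "(\<Sum>s\<in>UNIV. of_real (of_bool (r = p) * of_bool (s = p)) * F (matrix_unit r s) $ x $ x)
        = (\<Sum>s\<in>UNIV. if s = p then if r = p then F (matrix_unit p p) $ x $ x else 0 else 0)"
      by (rule sum.cong) auto
    then show ?thesis by simp
  qed
  show ?thesis
    using choi_entries_nonneg[OF assms, of "\<lambda>r. of_bool (r = p)" "\<lambda>_. x"]
    unfolding inner by simp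
qed

lemma two_le_card_UNIV_obtain:
  assumes "2 \<le> CARD('a::finite)"
  obtains x y :: "'a::finite" where "x \<noteq> y"
  using assms card_le_Suc0_iff_eq[of "UNIV :: 'a set"] by fastforce

section \<open>The characterisation\<close>

theorem theorem3p1:
  fixes n k :: nat and a b c d :: real
  assumes "n = CARD('n::finite)" and "k = CARD('k::finite)"
  shows "completely_positive (Phi a b c d :: ('n, 'k) bh \<Rightarrow> ('n, 'k) bh) \<longleftrightarrow>
    real n * real k * a + real k * b + (c + d) / (real n * real k) \<ge> 0 \<and>
    (n \<ge> 2 \<longrightarrow> real k * b + (c + d) / (real n * real k) \<ge> 0) \<and>
    (k \<ge> 2 \<longrightarrow> c + d \<ge> 0) \<and>
    (n \<ge> 2 \<longrightarrow> d \<ge> 0)"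
    (is "?cp \<longleftrightarrow> ?l1 \<ge> 0 \<and> (_ \<longrightarrow> ?l2 \<ge> 0) \<and> _ \<and> _")
proof
  have n: "n > 0" and k: "k > 0" by (simp_all add: assms)
  assume cp: ?cp
  \<comment> \<open>test vector \<open>\<Omega>\<close>\<close>
  have "0 \<le> real n * ?l1"
    using choi_block_vector_nonneg[OF cp, of "\<lambda>_. 1"]
    by (simp add: assms power2_eq_square algebra_simps)
  then have 1: "?l1 \<ge> 0" using n by (simp add: zero_le_mult_iff)
  have 2: "?l2 \<ge> 0" if "n \<ge> 2"
  proof -
    have "2 \<le> CARD('n)"
      using that assms by simp
    then obtain i i' :: 'n where "i \<noteq> i'"
      by (rule two_le_card_UNIV_obtain)
    then have s: "(\<Sum>r\<in>UNIV. of_bool (r = i) - of_bool (r = i')) = (0::real)"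
      and s2: "(\<Sum>r\<in>UNIV. (of_bool (r = i) - of_bool (r = i'))\<^sup>2) = (2::real)"
    proof -
      show "(\<Sum>r\<in>UNIV. of_bool (r = i) - of_bool (r = i')) = (0::real)"
        by (simp add: sum_subtractf)
      have "(\<Sum>r\<in>UNIV. (of_bool (r = i) - of_bool (r = i'))\<^sup>2) = (\<Sum>r\<in>UNIV. of_bool (r = i) + of_bool (r = i') :: real)"
        using \<open>i \<noteq> i'\<close> by (intro sum.cong) auto
      then show "(\<Sum>r\<in>UNIV. (of_bool (r = i) - of_bool (r = i'))\<^sup>2) = (2::real)"
        by (simp add: sum.distrib)
    qed
    \<comment> \<open>test vector \<open>\<Omega>\<^sub>i\<close> minus the corresponding vector of the block \<open>i'\<close>\<close>
    have "0 \<le> ?l2 * 2"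
      using choi_block_vector_nonneg[OF cp, of "\<lambda>r. of_bool (r = i) - of_bool (r = i')"]
      unfolding s s2 assms by simp
    then show ?thesis by (subst (asm) zero_le_mult_iff) simp
  qed
  \<comment> \<open>test vector \<open>e\<^sub>p \<otimes> e\<^sub>x\<close> with \<open>p \<noteq> x\<close> in the same, arbitrary block\<close>
  have 3: "c + d \<ge> 0" if "k \<ge> 2"
  proof -
    have "2 \<le> CARD('k)"
      using that assms by simp
    then obtain j j' :: 'k where "j \<noteq> j'"
      by (rule two_le_card_UNIV_obtain)
    then show ?thesis
      using choi_diagonal_nonneg[OF cp, of "(undefined, j)" "(undefined, j')"] n k
      by (simp add: Phi_matrix_unit_nth zero_le_divide_iff mult_le_0_iff flip: assms del: of_real_add of_real_divide)
  qed
  \<comment> \<open>test vector \<open>e\<^sub>p \<otimes> e\<^sub>x\<close> with \<open>p\<close> and \<open>x\<close> in different blocks\<close>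
  have 4: "d \<ge> 0" if "n \<ge> 2"
  proof -
    have "2 \<le> CARD('n)"
      using that assms by simp
    then obtain i i' :: 'n where "i \<noteq> i'"
      by (rule two_le_card_UNIV_obtain)
    then show ?thesis
      using choi_diagonal_nonneg[OF cp, of "(i, undefined)" "(i', undefined)"] n k
      by (simp add: Phi_matrix_unit_nth zero_le_divide_iff mult_le_0_iff flip: assms del: of_real_add of_real_divide)
  qed
  from 1 2 3 4 show "?l1 \<ge> 0 \<and> (n \<ge> 2 \<longrightarrow> ?l2 \<ge> 0) \<and> (k \<ge> 2 \<longrightarrow> c + d \<ge> 0) \<and> (n \<ge> 2 \<longrightarrow> d \<ge> 0)"
    by blast
next
  have n: "n > 0" and k: "k > 0" by (simp_all add: assms)
  assume *: "?l1 \<ge> 0 \<and> (n \<ge> 2 \<longrightarrow> ?l2 \<ge> 0) \<and> (k \<ge> 2 \<longrightarrow> c + d \<ge> 0) \<and> (n \<ge> 2 \<longrightarrow> d \<ge> 0)"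
  have EI: "completely_positive (\<lambda>X :: ('n, 'k) bh. (?l2 / (n * k)) *\<^sub>R (real n *\<^sub>R map_E X - map_I X))"
  proof (rule completely_positive_scaleR_or_zero[where P = "n \<ge> 2"])
    show "\<forall>X :: ('n, 'k) bh. real n *\<^sub>R map_E X - map_I X = 0" if "\<not> n \<ge> 2"
    proof -
      have "n = 1" using that n by simp
      with degenerate_n_E[where 'n = 'n and 'k = 'k] show ?thesis
        by (simp add: assms Phi_def fun_eq_iff)
    qed
  qed (use * completely_positive_nE_minus_I in \<open>auto simp: assms\<close>)
  have BE: "completely_positive (\<lambda>X :: ('n, 'k) bh.
      ((c + d) / (real n * (real k)\<^sup>2)) *\<^sub>R ((real n * (real k)\<^sup>2) *\<^sub>R map_B X - map_E X))"
  proof (rule completely_positive_scaleR_or_zero[where P = "k \<ge> 2"])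
    show "\<forall>X :: ('n, 'k) bh. (real n * (real k)\<^sup>2) *\<^sub>R map_B X - map_E X = 0" if "\<not> k \<ge> 2"
    proof -
      have "k = 1" using that k by simp
      with degenerate_k[where 'n = 'n and 'k = 'k] show ?thesis
        by (simp add: assms Phi_def fun_eq_iff)
    qed
  qed (use * completely_positive_nkkB_minus_E in \<open>auto simp: assms\<close>)
  have DB: "completely_positive (\<lambda>X :: ('n, 'k) bh. d *\<^sub>R (map_D X - map_B X))"
  proof (rule completely_positive_scaleR_or_zero[where P = "n \<ge> 2"])
    show "\<forall>X :: ('n, 'k) bh. map_D X - map_B X = 0" if "\<not> n \<ge> 2"
    proof -
      have "n = 1" using that n by simp
      with degenerate_n_B[where 'n = 'n and 'k = 'k] show ?thesis
        by (simp add: assms Phi_def fun_eq_iff)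
    qed
  qed (use * completely_positive_D_minus_B in auto)
  have "completely_positive (\<lambda>X :: ('n, 'k) bh. (?l1 / (n * k)) *\<^sub>R map_I X)"
    using * by (intro completely_positive_scaleR completely_positive_I) auto
  note completely_positive_add[OF completely_positive_add[OF completely_positive_add[OF this EI] BE] DB]
  moreover have "Phi a b c d X = (?l1 / (n * k)) *\<^sub>R map_I X
      + (?l2 / (n * k)) *\<^sub>R (real n *\<^sub>R map_E X - map_I X)
      + ((c + d) / (real n * (real k)\<^sup>2)) *\<^sub>R ((real n * (real k)\<^sup>2) *\<^sub>R map_B X - map_E X)
      + d *\<^sub>R (map_D X - map_B X)" for X :: "('n, 'k) bh"
  proof -
    have "?l1 / (n * k) - ?l2 / (n * k) = a"
      and "?l2 / (n * k) * n - (c + d) / (real n * (real k)\<^sup>2) = b"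
      and "(c + d) / (real n * (real k)\<^sup>2) * (real n * (real k)\<^sup>2) - d = c"
      using n k by (simp_all add: field_simps power2_eq_square)
    then show ?thesis
      by (simp only: Phi_regroup)
  qed
  ultimately show ?cp by presburger
qed

end
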